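(* Let $H_0, H_1, \ldots, H_{n-1}$ be a sort signature, i.e.\ a list in which each $H_i$ is a functor $H_i : \mathcal{C}_i \Rightarrow \mathsf{Set}$, where $\mathcal{C}_0$ is the terminal category and $\mathcal{C}_{i+1}$ is obtained from $\mathcal{C}_i$ and $H_i$ as described in the context. Then the base category $\mathcal{C}_n$ has all small limits.
   Context: The ambient framework is Martin-Löf type theory with function extensionality; $\mathsf{Set}$ denotes a universe of types satisfying uniqueness of identity proofs (sets), and also the category of sets and functions. Categories are precategories in the sense of the HoTT book. Given a category $\mathcal{C}_i$ and a functor $H_i : \mathcal{C}_i \Rightarrow \mathsf{Set}$, the category $\mathcal{C}_{i+1}$ has as objects pairs $(X,P)$ with $X$ an object of $\mathcal{C}_i$ and $P : H_i(X) \to \mathsf{Set}$ a family of sets; a morphism $(f,g) : (X,P) \to (Y,Q)$ consists of a morphism $f : X \to Y$ in $\mathcal{C}_i$ and a dependent function $g : (x : H_i(X)) \to P(x) \to Q(H_i(f)\,x)$. The category $\mathcal{C}_0$ is the terminal category (one object, one morphism). $\mathcal{C}_n$ is called the base category of the signature. A small limit is a limit of a diagram $D : \mathcal{I} \to \mathcal{C}$ whose shape category $\mathcal{I}$ has a set of objects and hom-sets that are sets. *)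

theory Defs
  imports "HOL-Library.FuncSet"
begin

(* Precategories with typed (object-indexed) identities and composition.
   Comp C x y z g f is  g \<circ> f  for f : x \<rightarrow> y, g : y \<rightarrow> z. *)
record ('o, 'm) cat =
  Obj  :: "'o set"
  Hom  :: "'o \<Rightarrow> 'o \<Rightarrow> 'm set"
  Id   :: "'o \<Rightarrow> 'm"
  Comp :: "'o \<Rightarrow> 'o \<Rightarrow> 'o \<Rightarrow> 'm \<Rightarrow> 'm \<Rightarrow> 'm"

definition category :: "('o, 'm, 'z) cat_scheme \<Rightarrow> bool" where
  "category C \<longleftrightarrow>
     (\<forall>x\<in>Obj C. Id C x \<in> Hom C x x) \<and>
     (\<forall>x\<in>Obj C. \<forall>y\<in>Obj C. \<forall>z\<in>Obj C. \<forall>f\<in>Hom C x y. \<forall>g\<in>Hom C y z.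
         Comp C x y z g f \<in> Hom C x z) \<and>
     (\<forall>x\<in>Obj C. \<forall>y\<in>Obj C. \<forall>f\<in>Hom C x y.
         Comp C x y y (Id C y) f = f \<and> Comp C x x y f (Id C x) = f) \<and>
     (\<forall>w\<in>Obj C. \<forall>x\<in>Obj C. \<forall>y\<in>Obj C. \<forall>z\<in>Obj C.
        \<forall>f\<in>Hom C w x. \<forall>g\<in>Hom C x y. \<forall>h\<in>Hom C y z.
         Comp C w y z h (Comp C w x y g f) = Comp C w x z (Comp C x y z h g) f)"

record ('o, 'm, 'o2, 'm2) fctr =
  FO :: "'o \<Rightarrow> 'o2"
  FM :: "'o \<Rightarrow> 'o \<Rightarrow> 'm \<Rightarrow> 'm2"

definition is_functor ::
  "('o, 'm) cat \<Rightarrow> ('o2, 'm2) cat \<Rightarrow> ('o, 'm, 'o2, 'm2) fctr \<Rightarrow> bool" where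
  "is_functor C D F \<longleftrightarrow> category C \<and> category D \<and>
     (\<forall>x\<in>Obj C. FO F x \<in> Obj D) \<and>
     (\<forall>x\<in>Obj C. \<forall>y\<in>Obj C. \<forall>f\<in>Hom C x y. FM F x y f \<in> Hom D (FO F x) (FO F y)) \<and>
     (\<forall>x\<in>Obj C. FM F x x (Id C x) = Id D (FO F x)) \<and>
     (\<forall>x\<in>Obj C. \<forall>y\<in>Obj C. \<forall>z\<in>Obj C. \<forall>f\<in>Hom C x y. \<forall>g\<in>Hom C y z.
        FM F x z (Comp C x y z g f) = Comp D (FO F x) (FO F y) (FO F z) (FM F y z g) (FM F x y f))"

definition SetCat :: "('u set, 'u \<Rightarrow> 'u) cat" where
  "SetCat = \<lparr> Obj = UNIV,
              Hom = (\<lambda>X Y. PiE X (\<lambda>_. Y)),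
              Id = (\<lambda>X. restrict (\<lambda>x. x) X),
              Comp = (\<lambda>X Y Z g f. restrict (g \<circ> f) X) \<rparr>"

(* Objects of C_i: lists [P_{i-1}, ..., P_0] (last-added family first);
   morphisms: lists [g_{i-1}, ..., g_0]. *)
type_synonym 'u sobj = "('u \<Rightarrow> 'u set) list"
type_synonym 'u smor = "('u \<Rightarrow> 'u \<Rightarrow> 'u) list"
type_synonym 'u scat = "('u sobj, 'u smor) cat"
type_synonym 'u sfun = "('u sobj, 'u smor, 'u set, 'u \<Rightarrow> 'u) fctr"

definition terminal_cat :: "'u scat" where
  "terminal_cat = \<lparr> Obj = {[]}, Hom = (\<lambda>_ _. {[]}), Id = (\<lambda>_. []),
                    Comp = (\<lambda>_ _ _ _ _. []) \<rparr>"

(* Object (X,P) is encoded as P # X, morphism (f,g) as g # f.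
   P is a family of sets over H(X) (empty outside H(X)); g is a dependent function,
   extensional (undefined outside its domain). *)
definition ext_cat :: "'u scat \<Rightarrow> 'u sfun \<Rightarrow> 'u scat" where
  "ext_cat C H = \<lparr>
     Obj = {P # X | P X. X \<in> Obj C \<and> (\<forall>x. x \<notin> FO H X \<longrightarrow> P x = {})},
     Hom = (\<lambda>A B. {g # f | g f. f \<in> Hom C (tl A) (tl B) \<and>
              (\<forall>x\<in>FO H (tl A). \<forall>p\<in>hd A x. g x p \<in> hd B (FM H (tl A) (tl B) f x)) \<and>
              (\<forall>x p. \<not> (x \<in> FO H (tl A) \<and> p \<in> hd A x) \<longrightarrow> g x p = undefined)}),
     Id = (\<lambda>A. (\<lambda>x p. if x \<in> FO H (tl A) \<and> p \<in> hd A x then p else undefined) # Id C (tl A)),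
     Comp = (\<lambda>A B D gs fs.
        (\<lambda>x p. if x \<in> FO H (tl A) \<and> p \<in> hd A x
               then hd gs (FM H (tl A) (tl B) (tl fs) x) (hd fs x p) else undefined)
        # Comp C (tl A) (tl B) (tl D) (tl gs) (tl fs)) \<rparr>"

definition tower :: "'u sfun list \<Rightarrow> 'u scat" where
  "tower Hs = foldl ext_cat terminal_cat Hs"

definition sort_signature :: "'u sfun list \<Rightarrow> bool" where
  "sort_signature Hs \<longleftrightarrow>
     (\<forall>i<length Hs. is_functor (tower (take i Hs)) SetCat (Hs ! i))"

definition is_cone ::
  "('i, 'j) cat \<Rightarrow> ('o, 'm) cat \<Rightarrow> ('i, 'j, 'o, 'm) fctr \<Rightarrow> 'o \<Rightarrow> ('i \<Rightarrow> 'm) \<Rightarrow> bool" where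
  "is_cone I C D c \<pi> \<longleftrightarrow> c \<in> Obj C \<and>
     (\<forall>i\<in>Obj I. \<pi> i \<in> Hom C c (FO D i)) \<and>
     (\<forall>i\<in>Obj I. \<forall>j\<in>Obj I. \<forall>u\<in>Hom I i j.
        Comp C c (FO D i) (FO D j) (FM D i j u) (\<pi> i) = \<pi> j)"

definition is_limit ::
  "('i, 'j) cat \<Rightarrow> ('o, 'm) cat \<Rightarrow> ('i, 'j, 'o, 'm) fctr \<Rightarrow> 'o \<Rightarrow> ('i \<Rightarrow> 'm) \<Rightarrow> bool" where
  "is_limit I C D c \<pi> \<longleftrightarrow> is_cone I C D c \<pi> \<and>
     (\<forall>c' \<pi>'. is_cone I C D c' \<pi>' \<longrightarrow>
        (\<exists>!h. h \<in> Hom C c' c \<and> (\<forall>i\<in>Obj I. Comp C c' c (FO D i) (\<pi> i) h = \<pi>' i)))"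

definition has_limits_of_shape :: "('i, 'j) cat \<Rightarrow> ('o, 'm) cat \<Rightarrow> bool" where
  "has_limits_of_shape I C \<longleftrightarrow>
     (\<forall>D. is_functor I C D \<longrightarrow> (\<exists>c \<pi>. is_limit I C D c \<pi>))"

end

theory Submission
  imports Defs
begin

text \<open>
  Limits in \<open>C\<^sub>i\<^sub>+\<^sub>1\<close> are computed componentwise. Given a diagram \<open>i \<mapsto> (X\<^sub>i, P\<^sub>i)\<close>, take a limit
  \<open>(L, \<pi>)\<close> of the \<open>X\<^sub>i\<close> in \<open>C\<^sub>i\<close>; over a point \<open>x \<in> H(L)\<close> the new family is the limit in
  \<open>Set\<close> of the sets \<open>P\<^sub>i(H(\<pi>\<^sub>i) x)\<close>, i.e. the set of matching families. Functoriality of \<open>H\<close>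
  makes a cone over the diagram factor through \<open>L\<close> in the first component and through the
  matching families in the second. Induction along the signature, starting from the
  terminal category, gives the theorem. Smallness of the shape is what lets the matching
  families, elements of \<open>'i \<Rightarrow> 'u\<close>, be coded back into the universe \<open>'u\<close>.
\<close>

lemma tower_snoc: "tower (Hs @ [H]) = ext_cat (tower Hs) H"
  by (simp add: tower_def)

lemma sort_signature_snocD:
  assumes "sort_signature (Hs @ [H])"
  shows "sort_signature Hs" and "is_functor (tower Hs) SetCat H"
proof -
  show "sort_signature Hs"
    unfolding sort_signature_def
  proof (intro allI impI)
    fix i assume "i < length Hs"
    with assms have "is_functor (tower (take i (Hs @ [H]))) SetCat ((Hs @ [H]) ! i)"
      unfolding sort_signature_def by simp
    with \<open>i < length Hs\<close> show "is_functor (tower (take i Hs)) SetCat (Hs ! i)"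
      by (simp add: nth_append)
  qed
  from assms[unfolded sort_signature_def, rule_format, of "length Hs"]
  show "is_functor (tower Hs) SetCat H" by simp
qed

lemma terminal_cat_has_limits: "has_limits_of_shape I terminal_cat"
  unfolding has_limits_of_shape_def
proof (intro allI impI)
  fix D
  have "is_limit I terminal_cat D [] (\<lambda>_. [])"
    unfolding is_limit_def is_cone_def terminal_cat_def by auto
  then show "\<exists>c \<pi>. is_limit I terminal_cat D c \<pi>" by blast
qed

lemma SetCat_simps:
  "Hom SetCat X Y = PiE X (\<lambda>_. Y)"
  "Id SetCat X = restrict (\<lambda>x. x) X"
  "Comp SetCat X Y Z g f = restrict (g \<circ> f) X"
  unfolding SetCat_def by simp_all

lemma ext_cat_Obj_iff:
  "A \<in> Obj (ext_cat C H) \<longleftrightarrow>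
     A \<noteq> [] \<and> tl A \<in> Obj C \<and> (\<forall>x. x \<notin> FO H (tl A) \<longrightarrow> hd A x = {})"
  unfolding ext_cat_def by (cases A) auto

lemma ext_cat_Hom_iff:
  "f \<in> Hom (ext_cat C H) A B \<longleftrightarrow> f \<noteq> [] \<and> tl f \<in> Hom C (tl A) (tl B) \<and>
     (\<forall>x\<in>FO H (tl A). \<forall>p\<in>hd A x. hd f x p \<in> hd B (FM H (tl A) (tl B) (tl f) x)) \<and>
     (\<forall>x p. \<not> (x \<in> FO H (tl A) \<and> p \<in> hd A x) \<longrightarrow> hd f x p = undefined)"
  unfolding ext_cat_def by (cases f) auto

lemma ext_cat_Id:
  "Id (ext_cat C H) A =
     (\<lambda>x p. if x \<in> FO H (tl A) \<and> p \<in> hd A x then p else undefined) # Id C (tl A)"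
  unfolding ext_cat_def by simp

lemma ext_cat_Comp:
  "Comp (ext_cat C H) A B E g f =
     (\<lambda>x p. if x \<in> FO H (tl A) \<and> p \<in> hd A x
            then hd g (FM H (tl A) (tl B) (tl f) x) (hd f x p) else undefined)
     # Comp C (tl A) (tl B) (tl E) (tl g) (tl f)"
  unfolding ext_cat_def by simp

definition base_diagram ::
  "('i, 'j, 'u sobj, 'u smor) fctr \<Rightarrow> ('i, 'j, 'u sobj, 'u smor) fctr" where
  "base_diagram D = \<lparr>FO = \<lambda>i. tl (FO D i), FM = \<lambda>i j u. tl (FM D i j u)\<rparr>"

lemma is_functor_base_diagram:
  assumes "is_functor I (ext_cat C H) D" and "category C"
  shows "is_functor I C (base_diagram D)"
  using assms unfolding is_functor_def base_diagram_def
  by (simp add: ext_cat_Obj_iff ext_cat_Hom_iff ext_cat_Id ext_cat_Comp)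

lemma is_cone_base_diagram:
  assumes "is_cone I (ext_cat C H) D c \<sigma>"
  shows "is_cone I C (base_diagram D) (tl c) (\<lambda>i. tl (\<sigma> i))"
  unfolding is_cone_def base_diagram_def
proof (intro conjI ballI, simp_all)
  show "tl c \<in> Obj C" and "\<And>i. i \<in> Obj I \<Longrightarrow> tl (\<sigma> i) \<in> Hom C (tl c) (tl (FO D i))"
    using assms by (auto simp: is_cone_def ext_cat_Obj_iff ext_cat_Hom_iff)
  fix i j u assume "i \<in> Obj I" "j \<in> Obj I" "u \<in> Hom I i j"
  with assms have "tl (Comp (ext_cat C H) c (FO D i) (FO D j) (FM D i j u) (\<sigma> i)) = tl (\<sigma> j)"
    by (simp add: is_cone_def)
  then show "Comp C (tl c) (tl (FO D i)) (tl (FO D j)) (tl (FM D i j u)) (tl (\<sigma> i)) = tl (\<sigma> j)"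
    by (simp add: ext_cat_Comp)
qed

locale lifted_diagram =
  fixes C :: "'u scat" and H :: "'u sfun" and I :: "('i, 'j) cat"
    and D :: "('i, 'j, 'u sobj, 'u smor) fctr"
    and e :: "('i \<Rightarrow> 'u) \<Rightarrow> 'u"
    and L :: "'u sobj" and \<pi> :: "'i \<Rightarrow> 'u smor"
  assumes functor_H: "is_functor C SetCat H"
    and diagram: "is_functor I (ext_cat C H) D"
    and inj_e: "inj e"
    and base_limit: "is_limit I C (base_diagram D) L \<pi>"
begin

lemma L_Obj: "L \<in> Obj C"
  and \<pi>_Hom: "i \<in> Obj I \<Longrightarrow> \<pi> i \<in> Hom C L (tl (FO D i))"
  and \<pi>_Comp: "i \<in> Obj I \<Longrightarrow> j \<in> Obj I \<Longrightarrow> u \<in> Hom I i j \<Longrightarrow>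
      Comp C L (tl (FO D i)) (tl (FO D j)) (tl (FM D i j u)) (\<pi> i) = \<pi> j"
  using base_limit unfolding is_limit_def is_cone_def base_diagram_def by auto

lemma D_Obj: "i \<in> Obj I \<Longrightarrow> FO D i \<in> Obj (ext_cat C H)"
  using diagram by (simp add: is_functor_def)

definition point_at :: "'i \<Rightarrow> 'u \<Rightarrow> 'u" where
  "point_at i x = FM H L (tl (FO D i)) (\<pi> i) x"

definition matching_family :: "'u \<Rightarrow> ('i \<Rightarrow> 'u) \<Rightarrow> bool" where
  "matching_family x p \<longleftrightarrow> p \<in> PiE (Obj I) (\<lambda>i. hd (FO D i) (point_at i x)) \<and>
     (\<forall>i\<in>Obj I. \<forall>j\<in>Obj I. \<forall>u\<in>Hom I i j. hd (FM D i j u) (point_at i x) (p i) = p j)"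

definition limit_family :: "'u \<Rightarrow> 'u set" where
  "limit_family x = (if x \<in> FO H L then e ` Collect (matching_family x) else {})"

definition limit_proj :: "'i \<Rightarrow> 'u smor" where
  "limit_proj i =
     (\<lambda>x q. if x \<in> FO H L \<and> q \<in> limit_family x then inv e q i else undefined) # \<pi> i"

lemma tl_limit_proj [simp]: "tl (limit_proj i) = \<pi> i"
  by (simp add: limit_proj_def)

lemma limit_familyD:
  assumes "q \<in> limit_family x"
  shows "x \<in> FO H L" and "matching_family x (inv e q)" and "e (inv e q) = q"
  using assms inj_e unfolding limit_family_def by (auto split: if_splits)

lemma limit_family_cone: "is_cone I (ext_cat C H) D (limit_family # L) limit_proj"
  unfolding is_cone_def
proof (intro conjI ballI)
  show "limit_family # L \<in> Obj (ext_cat C H)"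
    using L_Obj by (simp add: ext_cat_Obj_iff limit_family_def)
next
  fix i assume i: "i \<in> Obj I"
  show "limit_proj i \<in> Hom (ext_cat C H) (limit_family # L) (FO D i)"
    using i \<pi>_Hom limit_familyD(2)
    by (auto simp: ext_cat_Hom_iff limit_proj_def matching_family_def point_at_def)
next
  fix i j u assume i: "i \<in> Obj I" and j: "j \<in> Obj I" and u: "u \<in> Hom I i j"
  have "hd (FM D i j u) (point_at i x) (inv e q i) = inv e q j" if "q \<in> limit_family x" for x q
    using limit_familyD(2)[OF that] i j u by (simp add: matching_family_def)
  then show "Comp (ext_cat C H) (limit_family # L) (FO D i) (FO D j) (FM D i j u) (limit_proj i)
      = limit_proj j"
    by (simp add: ext_cat_Comp limit_proj_def point_at_def \<pi>_Comp[OF i j u] fun_eq_iff)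
qed

end

locale lifted_cone = lifted_diagram +
  fixes c and \<sigma>
  assumes cone: "is_cone I (ext_cat C H) D c \<sigma>"
begin

lemma tl_c_Obj: "tl c \<in> Obj C"
  using cone by (simp add: is_cone_def ext_cat_Obj_iff)

lemma \<sigma>_Hom: "i \<in> Obj I \<Longrightarrow> \<sigma> i \<in> Hom (ext_cat C H) c (FO D i)"
  and \<sigma>_Comp: "i \<in> Obj I \<Longrightarrow> j \<in> Obj I \<Longrightarrow> u \<in> Hom I i j \<Longrightarrow>
      Comp (ext_cat C H) c (FO D i) (FO D j) (FM D i j u) (\<sigma> i) = \<sigma> j"
  using cone by (auto simp: is_cone_def)

definition base_mediator where
  "base_mediator = (THE h. h \<in> Hom C (tl c) L \<and>
     (\<forall>i\<in>Obj I. Comp C (tl c) L (tl (FO D i)) (\<pi> i) h = tl (\<sigma> i)))"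

lemma base_mediator_unique:
  "\<exists>!h. h \<in> Hom C (tl c) L \<and> (\<forall>i\<in>Obj I. Comp C (tl c) L (tl (FO D i)) (\<pi> i) h = tl (\<sigma> i))"
  using base_limit is_cone_base_diagram[OF cone]
  unfolding is_limit_def base_diagram_def by simp

lemma base_mediator_Hom: "base_mediator \<in> Hom C (tl c) L"
  and base_mediator_Comp:
    "i \<in> Obj I \<Longrightarrow> Comp C (tl c) L (tl (FO D i)) (\<pi> i) base_mediator = tl (\<sigma> i)"
  using theI'[OF base_mediator_unique] unfolding base_mediator_def by auto

lemma base_mediator_eqI:
  "h \<in> Hom C (tl c) L \<Longrightarrow> (\<And>i. i \<in> Obj I \<Longrightarrow> Comp C (tl c) L (tl (FO D i)) (\<pi> i) h = tl (\<sigma> i))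
    \<Longrightarrow> h = base_mediator"
  using the1_equality[OF base_mediator_unique] unfolding base_mediator_def by blast

lemma FM_base_mediator:
  "x \<in> FO H (tl c) \<Longrightarrow> FM H (tl c) L base_mediator x \<in> FO H L"
  using functor_H base_mediator_Hom tl_c_Obj L_Obj
  unfolding is_functor_def SetCat_simps by blast

lemma point_at_base_mediator:
  assumes i: "i \<in> Obj I" and x: "x \<in> FO H (tl c)"
  shows "point_at i (FM H (tl c) L base_mediator x) = FM H (tl c) (tl (FO D i)) (tl (\<sigma> i)) x"
proof -
  have "tl (FO D i) \<in> Obj C" using D_Obj[OF i] by (simp add: ext_cat_Obj_iff)
  then have "FM H (tl c) (tl (FO D i)) (Comp C (tl c) L (tl (FO D i)) (\<pi> i) base_mediator) =
      Comp SetCat (FO H (tl c)) (FO H L) (FO H (tl (FO D i)))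
        (FM H L (tl (FO D i)) (\<pi> i)) (FM H (tl c) L base_mediator)"
    using functor_H tl_c_Obj L_Obj base_mediator_Hom \<pi>_Hom[OF i] unfolding is_functor_def by blast
  then show ?thesis
    using base_mediator_Comp[OF i] x by (simp add: SetCat_simps point_at_def)
qed

lemma matching_family_of_cone:
  assumes x: "x \<in> FO H (tl c)" and p: "p \<in> hd c x"
  shows "matching_family (FM H (tl c) L base_mediator x) (\<lambda>i\<in>Obj I. hd (\<sigma> i) x p)"
  unfolding matching_family_def
proof (intro conjI ballI)
  show "(\<lambda>i\<in>Obj I. hd (\<sigma> i) x p) \<in>
      PiE (Obj I) (\<lambda>i. hd (FO D i) (point_at i (FM H (tl c) L base_mediator x)))"
    using \<sigma>_Hom x p by (auto simp: ext_cat_Hom_iff point_at_base_mediator)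
next
  fix i j u assume i: "i \<in> Obj I" and j: "j \<in> Obj I" and u: "u \<in> Hom I i j"
  have "hd (Comp (ext_cat C H) c (FO D i) (FO D j) (FM D i j u) (\<sigma> i)) x p = hd (\<sigma> j) x p"
    using \<sigma>_Comp[OF i j u] by simp
  then show "hd (FM D i j u) (point_at i (FM H (tl c) L base_mediator x))
      ((\<lambda>i\<in>Obj I. hd (\<sigma> i) x p) i) = (\<lambda>i\<in>Obj I. hd (\<sigma> i) x p) j"
    using i j x p by (simp add: ext_cat_Comp point_at_base_mediator)
qed

definition mediator where
  "mediator = (\<lambda>x p. if x \<in> FO H (tl c) \<and> p \<in> hd c x then e (\<lambda>i\<in>Obj I. hd (\<sigma> i) x p)
                     else undefined) # base_mediator"

lemma mediator_Hom: "mediator \<in> Hom (ext_cat C H) c (limit_family # L)"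
  using base_mediator_Hom matching_family_of_cone FM_base_mediator
  by (auto simp: ext_cat_Hom_iff mediator_def limit_family_def)

lemma mediator_Comp:
  assumes i: "i \<in> Obj I"
  shows "Comp (ext_cat C H) c (limit_family # L) (FO D i) (limit_proj i) mediator = \<sigma> i"
proof -
  have \<sigma>_i: "\<sigma> i = hd (\<sigma> i) # tl (\<sigma> i)"
    and \<sigma>_undefined: "\<And>x p. \<not> (x \<in> FO H (tl c) \<and> p \<in> hd c x) \<Longrightarrow> hd (\<sigma> i) x p = undefined"
    using \<sigma>_Hom[OF i] by (simp_all add: ext_cat_Hom_iff)
  have "hd (limit_proj i) (FM H (tl c) L base_mediator x) (hd mediator x p) = hd (\<sigma> i) x p"
    if "x \<in> FO H (tl c)" and "p \<in> hd c x" for x p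
    using that i inj_e matching_family_of_cone FM_base_mediator
    by (simp add: mediator_def limit_proj_def limit_family_def)
  then show ?thesis
    using \<sigma>_undefined base_mediator_Comp[OF i]
    by (subst \<sigma>_i) (auto simp: ext_cat_Comp mediator_def fun_eq_iff)
qed

lemma mediator_unique:
  assumes h_Hom: "h \<in> Hom (ext_cat C H) c (limit_family # L)"
    and h_Comp: "\<And>i. i \<in> Obj I \<Longrightarrow>
      Comp (ext_cat C H) c (limit_family # L) (FO D i) (limit_proj i) h = \<sigma> i"
  shows "h = mediator"
proof -
  have tl_h: "tl h = base_mediator"
  proof (rule base_mediator_eqI)
    show "tl h \<in> Hom C (tl c) L" using h_Hom by (simp add: ext_cat_Hom_iff)
    show "Comp C (tl c) L (tl (FO D i)) (\<pi> i) (tl h) = tl (\<sigma> i)" if "i \<in> Obj I" for i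
      using arg_cong[OF h_Comp[OF that], of tl] by (simp add: ext_cat_Comp limit_proj_def)
  qed
  have hd_h: "hd h = hd mediator"
  proof (intro ext)
    fix x p
    show "hd h x p = hd mediator x p"
    proof (cases "x \<in> FO H (tl c) \<and> p \<in> hd c x")
      case True
      let ?q = "hd h x p"
      have q: "?q \<in> limit_family (FM H (tl c) L base_mediator x)"
        using h_Hom True tl_h by (auto simp: ext_cat_Hom_iff)
      have "inv e ?q i = hd (\<sigma> i) x p" if i: "i \<in> Obj I" for i
        using arg_cong[OF h_Comp[OF i], of "\<lambda>f. hd f x p"] True q tl_h limit_familyD(1)[OF q]
        by (simp add: ext_cat_Comp limit_proj_def)
      moreover have "inv e ?q \<in> extensional (Obj I)"
        using limit_familyD(2)[OF q] by (simp add: matching_family_def PiE_def)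
      ultimately have "inv e ?q = (\<lambda>i\<in>Obj I. hd (\<sigma> i) x p)"
        by (auto simp: extensional_def)
      then show ?thesis
        using limit_familyD(3)[OF q] True by (simp add: mediator_def)
    next
      case False
      then show ?thesis using h_Hom by (auto simp: ext_cat_Hom_iff mediator_def)
    qed
  qed
  have "h = hd h # tl h" using h_Hom by (simp add: ext_cat_Hom_iff)
  also have "\<dots> = mediator" using hd_h tl_h by (simp add: mediator_def)
  finally show ?thesis .
qed

end

lemma (in lifted_diagram) limit_family_limit:
  "is_limit I (ext_cat C H) D (limit_family # L) limit_proj"
  unfolding is_limit_def
proof (intro conjI allI impI limit_family_cone)
  fix c \<sigma> assume "is_cone I (ext_cat C H) D c \<sigma>"
  then interpret lifted_cone C H I D e L \<pi> c \<sigma>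
    by unfold_locales
  show "\<exists>!h. h \<in> Hom (ext_cat C H) c (limit_family # L) \<and>
      (\<forall>i\<in>Obj I. Comp (ext_cat C H) c (limit_family # L) (FO D i) (limit_proj i) h = \<sigma> i)"
    using mediator_Hom mediator_Comp mediator_unique by blast
qed

lemma ext_cat_has_limits:
  fixes C :: "'u scat" and I :: "('i, 'j) cat" and e :: "('i \<Rightarrow> 'u) \<Rightarrow> 'u"
  assumes functor_H: "is_functor C SetCat H" and limits: "has_limits_of_shape I C"
    and "inj e"
  shows "has_limits_of_shape I (ext_cat C H)"
  unfolding has_limits_of_shape_def
proof (intro allI impI)
  fix D assume diagram: "is_functor I (ext_cat C H) D"
  have "category C" using functor_H by (simp add: is_functor_def)
  with diagram limits obtain L \<pi> where "is_limit I C (base_diagram D) L \<pi>"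
    unfolding has_limits_of_shape_def using is_functor_base_diagram by blast
  with assms diagram interpret lifted_diagram C H I D e L \<pi>
    by unfold_locales
  show "\<exists>c \<pi>. is_limit I (ext_cat C H) D c \<pi>"
    using limit_family_limit by blast
qed

theorem mainTheorem1:
  fixes Hs :: "'u sfun list" and I :: "('i, 'j) cat"
  assumes "sort_signature Hs"
    and "category I"
    and "\<exists>e :: ('i \<Rightarrow> 'u) \<Rightarrow> 'u. inj e"
  shows "has_limits_of_shape I (tower Hs)"
proof -
  obtain e :: "('i \<Rightarrow> 'u) \<Rightarrow> 'u" where e: "inj e" using assms(3) by blast
  show ?thesis using assms(1)
  proof (induction Hs rule: rev_induct)
    case Nil
    show ?case using terminal_cat_has_limits by (simp add: tower_def)
  next
    case (snoc H Hs)
    show ?case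
      unfolding tower_snoc
      using ext_cat_has_limits[OF sort_signature_snocD(2) snoc.IH e]
        sort_signature_snocD(1) snoc.prems by blast
  qed
qed

end
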